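(* Let $\pi$ be a probability measure on $\mathbb{R}^d$ with density $e^{-V}$, where $V:\mathbb{R}^d\to\mathbb{R}$ is twice continuously differentiable, and let $\phi$ be a mirror map. For each $t\ge 0$ let $\mu_t$ be the law at time $t$ of the mirror-Langevin diffusion with mirror map $\phi$ and target $\pi$. Suppose that $\pi$ satisfies the mirror Poincaré inequality with constant $C_{\mathsf{MP}}>0$, that is, $$\operatorname{var}_\pi g\le C_{\mathsf{MP}}\,\mathbb{E}_\pi\langle\nabla g,(\nabla^2\phi)^{-1}\nabla g\rangle\qquad\text{for all locally Lipschitz } g\in L^2(\pi).$$ Then for every $t\ge 0$, each of the four quantities $$2\|\mu_t-\pi\|_{\rm TV}^2,\quad H^2(\mu_t,\pi),\quad D_{\rm KL}(\mu_t\,\|\,\pi),\quad \chi^2(\mu_t\,\|\,\pi)$$ is at most $e^{-2t/C_{\mathsf{MP}}}\,\chi^2(\mu_0\,\|\,\pi)$.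
   Context: A mirror map is a strictly convex, twice continuously differentiable function $\phi$ on $\mathbb{R}^d$ of Legendre type (so $\nabla\phi$ is invertible, with inverse $\nabla\phi^\star$, where $\phi^\star$ is the convex conjugate). The mirror-Langevin diffusion $(X_t)_{t\ge0}$ with mirror map $\phi$ and target $\pi=e^{-V}$ is the solution of $$X_t=\nabla\phi^\star(Y_t),\qquad dY_t=-\nabla V(X_t)\,dt+\sqrt2\,[\nabla^2\phi(X_t)]^{1/2}\,dB_t,$$ with $(B_t)$ a standard Brownian motion in $\mathbb{R}^d$. Standing assumption: $\nabla^2\phi$ is invertible wherever its inverse is used, and $\phi,V$ are such that the law $\mu_t$ of $X_t$ (identified with its Lebesgue density) is the unique solution of the Fokker–Planck equation $\partial_t\mu_t=\operatorname{div}\bigl(\mu_t(\nabla^2\phi)^{-1}\nabla\ln\frac{\mu_t}{\pi}\bigr)$, with enough regularity that (when $\chi^2(\mu_0\|\pi)<\infty$) $\int\mu_t^2/\pi$ may be differentiated in $t$ under the integral sign and the resulting integral integrated by parts without boundary terms. Notation: $\operatorname{var}_\pi g=\int(g-\mathbb{E}_\pi g)^2\,d\pi$; $\chi^2(\mu\|\pi)=\int(\frac{d\mu}{d\pi})^2d\pi-1$ if $\mu\ll\pi$ and $+\infty$ otherwise; $D_{\rm KL}(\mu\|\pi)=\int\ln\frac{d\mu}{d\pi}\,d\mu$; $\|\mu-\pi\|_{\rm TV}=\sup_A|\mu(A)-\pi(A)|$; $H^2(\mu,\pi)=\int(\sqrt{\mu}-\sqrt{\pi})^2$ (Lebesgue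 densities). *)

theory Defs
  imports "HOL-Probability.Probability"
begin

section \<open>Calculus on Euclidean space\<close>

text \<open>Gradient, Hessian and divergence are meaningful only at points of differentiability, the matrix
  square root only for symmetric positive semidefinite matrices.\<close>

definition grad :: "(real^'d \<Rightarrow> real) \<Rightarrow> real^'d \<Rightarrow> real^'d" where
  "grad f x = (\<chi> i. frechet_derivative f (at x) (axis i 1))"

definition hess :: "(real^'d \<Rightarrow> real) \<Rightarrow> real^'d \<Rightarrow> real^'d^'d" where
  "hess f x = jacobian (grad f) (at x)"

definition divergence :: "(real^'d \<Rightarrow> real^'d) \<Rightarrow> real^'d \<Rightarrow> real" where
  "divergence G x = trace (jacobian G (at x))"

definition twice_continuously_differentiable :: "(real^'d \<Rightarrow> real) \<Rightarrow> bool" where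
  "twice_continuously_differentiable f \<longleftrightarrow>
     (\<forall>x. f differentiable at x) \<and> (\<forall>x. grad f differentiable at x) \<and> continuous_on UNIV (hess f)"

definition mat_sqrt :: "real^'d^'d \<Rightarrow> real^'d^'d" where
  "mat_sqrt A = (THE S. transpose S = S \<and> (\<forall>v. 0 \<le> v \<bullet> (S *v v)) \<and> S ** S = A)"

section \<open>Mirror maps\<close>

definition strictly_convex_on :: "'a::real_vector set \<Rightarrow> ('a \<Rightarrow> real) \<Rightarrow> bool" where
  "strictly_convex_on S f \<longleftrightarrow> convex S \<and>
     (\<forall>x\<in>S. \<forall>y\<in>S. \<forall>u. x \<noteq> y \<and> 0 < u \<and> u < 1 \<longrightarrow>
        f ((1 - u) *\<^sub>R x + u *\<^sub>R y) < (1 - u) * f x + u * f y)"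

text \<open>Rockafellar's notion for a function whose effective domain has interior S: strictly convex
  and essentially smooth. For S = UNIV the condition at the frontier is vacuous.\<close>

definition legendre_type :: "(real^'d) set \<Rightarrow> (real^'d \<Rightarrow> real) \<Rightarrow> bool" where
  "legendre_type S f \<longleftrightarrow> open S \<and> S \<noteq> {} \<and> strictly_convex_on S f \<and>
     (\<forall>x\<in>S. f differentiable at x) \<and>
     (\<forall>s z. (\<forall>n. s n \<in> S) \<and> z \<in> frontier S \<and> s \<longlonglongrightarrow> z \<longrightarrow>
        filterlim (\<lambda>n. norm (grad f (s n))) at_top sequentially)"

definition mirror_map :: "(real^'d \<Rightarrow> real) \<Rightarrow> bool" where
  "mirror_map \<phi> \<longleftrightarrow>
     strictly_convex_on UNIV \<phi> \<and> twice_continuously_differentiable \<phi> \<and> legendre_type UNIV \<phi>"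

definition convex_conjugate :: "(real^'d \<Rightarrow> real) \<Rightarrow> real^'d \<Rightarrow> ereal" where
  "convex_conjugate f y = (SUP x. ereal (x \<bullet> y - f x))"

text \<open>The gradient of a mirror map need not be onto, so the conjugate may be infinite in places;
  its gradient is only used on the interior of its effective domain, which is the range of the
  gradient of the mirror map.\<close>

definition conjugate_domain :: "(real^'d \<Rightarrow> real) \<Rightarrow> (real^'d) set" where
  "conjugate_domain f = interior {y. convex_conjugate f y < \<infinity>}"

definition grad_conjugate :: "(real^'d \<Rightarrow> real) \<Rightarrow> real^'d \<Rightarrow> real^'d" where
  "grad_conjugate f = grad (\<lambda>y. real_of_ereal (convex_conjugate f y))"

section \<open>The mirror-Langevin diffusion\<close>

definition brownian_motion ::
  "'w measure \<Rightarrow> (real \<Rightarrow> 'w measure) \<Rightarrow> (real \<Rightarrow> 'w \<Rightarrow> real^'d) \<Rightarrow> bool" where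
  "brownian_motion M F B \<longleftrightarrow>
     prob_space M \<and> filtration (space M) F \<and> (\<forall>t. subalgebra M (F t)) \<and>
     (\<forall>t\<ge>0. B t \<in> borel_measurable (F t)) \<and>
     (AE \<omega> in M. B 0 \<omega> = 0) \<and>
     (AE \<omega> in M. continuous_on {0..} (\<lambda>t. B t \<omega>)) \<and>
     (\<forall>s t. 0 \<le> s \<and> s < t \<longrightarrow>
        distributed M lborel (\<lambda>\<omega>. B t \<omega> - B s \<omega>)
          (\<lambda>x. ennreal (\<Prod>i\<in>UNIV. normal_density 0 (sqrt (t - s)) (x $ i))) \<and>
        prob_space.indep_set M (sets (F s))
          {(\<lambda>\<omega>. B t \<omega> - B s \<omega>) -` A \<inter> space M |A. A \<in> sets borel})"

text \<open>For an adapted integrand with continuous paths, the Ito integral over [0, t] is the limit in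
  probability of the left-endpoint Riemann sums. It is only used for such integrands.\<close>

definition ito_sum ::
  "(real \<Rightarrow> 'w \<Rightarrow> real^'d) \<Rightarrow> (real \<Rightarrow> 'w \<Rightarrow> real^'d^'d) \<Rightarrow> real \<Rightarrow> nat \<Rightarrow> 'w \<Rightarrow> real^'d" where
  "ito_sum B K t n \<omega> = (\<Sum>k<n. K (t * real k / real n) \<omega> *v
       (B (t * real (Suc k) / real n) \<omega> - B (t * real k / real n) \<omega>))"

definition ito_integral ::
  "'w measure \<Rightarrow> (real \<Rightarrow> 'w \<Rightarrow> real^'d) \<Rightarrow> (real \<Rightarrow> 'w \<Rightarrow> real^'d^'d) \<Rightarrow> real \<Rightarrow> ('w \<Rightarrow> real^'d) \<Rightarrow> bool" where
  "ito_integral M B K t I \<longleftrightarrow>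
     I \<in> borel_measurable M \<and> (\<forall>n. ito_sum B K t n \<in> borel_measurable M) \<and>
     (\<forall>\<epsilon>>0. (\<lambda>n. measure M {\<omega>\<in>space M. norm (ito_sum B K t n \<omega> - I \<omega>) > \<epsilon>}) \<longlonglongrightarrow> 0)"

definition mirror_langevin_diffusion ::
  "'w measure \<Rightarrow> (real \<Rightarrow> 'w measure) \<Rightarrow> (real \<Rightarrow> 'w \<Rightarrow> real^'d) \<Rightarrow> (real^'d \<Rightarrow> real) \<Rightarrow> (real^'d \<Rightarrow> real) \<Rightarrow>
   (real \<Rightarrow> 'w \<Rightarrow> real^'d) \<Rightarrow> (real \<Rightarrow> 'w \<Rightarrow> real^'d) \<Rightarrow> bool" where
  "mirror_langevin_diffusion M F B \<phi> V X Y \<longleftrightarrow>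
     brownian_motion M F B \<and>
     (\<forall>t\<ge>0. X t \<in> borel_measurable (F t) \<and> Y t \<in> borel_measurable (F t)) \<and>
     (AE \<omega> in M. continuous_on {0..} (\<lambda>t. Y t \<omega>)) \<and>
     (AE \<omega> in M. \<forall>t\<ge>0. Y t \<omega> \<in> conjugate_domain \<phi> \<and> X t \<omega> = grad_conjugate \<phi> (Y t \<omega>)) \<and>
     (\<exists>I. \<forall>t\<ge>0.
        ito_integral M B (\<lambda>s \<omega>. mat_sqrt (hess \<phi> (X s \<omega>))) t (I t) \<and>
        (AE \<omega> in M. Y t \<omega> = Y 0 \<omega> - integral {0..t} (\<lambda>s. grad V (X s \<omega>)) + sqrt 2 *\<^sub>R I t \<omega>))"

definition law :: "'w measure \<Rightarrow> (real \<Rightarrow> 'w \<Rightarrow> real^'d) \<Rightarrow> real \<Rightarrow> (real^'d) measure" where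
  "law M X t = distr M borel (X t)"

section \<open>Target measure, mirror Poincare inequality, divergences\<close>

definition target :: "(real^'d \<Rightarrow> real) \<Rightarrow> (real^'d) measure" where
  "target V = density lborel (\<lambda>x. ennreal (exp (- V x)))"

text \<open>A locally Lipschitz function is differentiable almost everywhere (Rademacher), so its gradient
  is determined up to a null set. The right-hand side may be infinite.\<close>

definition mirror_poincare :: "(real^'d \<Rightarrow> real) \<Rightarrow> (real^'d \<Rightarrow> real) \<Rightarrow> real \<Rightarrow> bool" where
  "mirror_poincare \<phi> V C \<longleftrightarrow>
     (\<forall>g. local_lipschitz {0::real} UNIV (\<lambda>_. g) \<and> integrable (target V) (\<lambda>x. (g x)\<^sup>2) \<longrightarrow>
        ennreal (\<integral>x. (g x - (\<integral>y. g y \<partial>target V))\<^sup>2 \<partial>target V)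
          \<le> ennreal C * (\<integral>\<^sup>+x. ennreal (grad g x \<bullet> (matrix_inv (hess \<phi> x) *v grad g x)) \<partial>target V))"

definition chi_square :: "'a measure \<Rightarrow> 'a measure \<Rightarrow> ereal" where
  "chi_square \<mu> \<pi> =
     (if absolutely_continuous \<pi> \<mu> then enn2ereal (\<integral>\<^sup>+x. (RN_deriv \<pi> \<mu> x)\<^sup>2 \<partial>\<pi>) - 1 else \<infinity>)"

text \<open>For probability measures the negative part of the log-density is always integrable, so a
  non-integrable log-density means an infinite divergence.\<close>

definition KL_div :: "'a measure \<Rightarrow> 'a measure \<Rightarrow> ereal" where
  "KL_div \<mu> \<pi> =
     (if absolutely_continuous \<pi> \<mu> \<and> integrable \<mu> (entropy_density (exp 1) \<pi> \<mu>)
      then ereal (KL_divergence (exp 1) \<pi> \<mu>) else \<infinity>)"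

definition TV_dist :: "'a measure \<Rightarrow> 'a measure \<Rightarrow> real" where
  "TV_dist \<mu> \<pi> = (SUP A\<in>sets \<pi>. \<bar>measure \<mu> A - measure \<pi> A\<bar>)"

text \<open>Meant for measures with Lebesgue densities.\<close>

definition hellinger_sq :: "(real^'d) measure \<Rightarrow> (real^'d) measure \<Rightarrow> ereal" where
  "hellinger_sq \<mu> \<pi> =
     enn2ereal (\<integral>\<^sup>+x. ennreal ((sqrt (enn2real (RN_deriv lborel \<mu> x))
                              - sqrt (enn2real (RN_deriv lborel \<pi> x)))\<^sup>2) \<partial>lborel)"

section \<open>Fokker--Planck equation and regularity\<close>

definition fp_flux :: "(real^'d \<Rightarrow> real) \<Rightarrow> (real^'d \<Rightarrow> real) \<Rightarrow> (real^'d \<Rightarrow> real) \<Rightarrow> real^'d \<Rightarrow> real^'d" where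
  "fp_flux \<phi> V p x = p x *\<^sub>R (matrix_inv (hess \<phi> x) *v grad (\<lambda>y. ln (p y / exp (- V y))) x)"

text \<open>Classical, positive solutions among probability densities, for positive times, with the
  initial law attained weakly. Positivity gives the logarithm in the equation a meaning.
  The value of m at time 0 is not constrained, as the initial law may lack a density.\<close>

definition fokker_planck_solution ::
  "(real^'d \<Rightarrow> real) \<Rightarrow> (real^'d \<Rightarrow> real) \<Rightarrow> (real^'d) measure \<Rightarrow> (real \<Rightarrow> real^'d \<Rightarrow> real) \<Rightarrow> bool" where
  "fokker_planck_solution \<phi> V \<mu>\<^sub>0 m \<longleftrightarrow>
     (\<forall>t>0. prob_space (density lborel (\<lambda>x. ennreal (m t x)))) \<and>
     (\<forall>t>0. \<forall>x. 0 < m t x \<and> m t differentiable at x \<and> fp_flux \<phi> V (m t) differentiable at x \<and>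
        ((\<lambda>s. m s x) has_real_derivative divergence (fp_flux \<phi> V (m t)) x) (at t)) \<and>
     (\<forall>f :: real^'d \<Rightarrow> real. continuous_on UNIV f \<and> bounded (range f) \<longrightarrow>
        ((\<lambda>t. \<integral>x. f x * m t x \<partial>lborel) \<longlongrightarrow> (\<integral>x. f x \<partial>\<mu>\<^sub>0)) (at_right 0))"

definition lebesgue_density :: "(real^'d) measure \<Rightarrow> (real^'d \<Rightarrow> real) \<Rightarrow> bool" where
  "lebesgue_density \<mu> f \<longleftrightarrow>
     f \<in> borel_measurable borel \<and> (\<forall>x. 0 \<le> f x) \<and> \<mu> = density lborel (\<lambda>x. ennreal (f x))"

text \<open>The integral of the squared density against the reciprocal target density is finite and
  continuous on [0, oo), and differentiable under the integral sign at positive times (a derivative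
  at time 0 is not required, since it may be infinite).\<close>

definition differentiable_under_integral :: "(real^'d \<Rightarrow> real) \<Rightarrow> (real \<Rightarrow> real^'d \<Rightarrow> real) \<Rightarrow> bool" where
  "differentiable_under_integral V m \<longleftrightarrow>
     (\<forall>t\<ge>0. integrable lborel (\<lambda>x. (m t x)\<^sup>2 / exp (- V x))) \<and>
     continuous_on {0..} (\<lambda>t. \<integral>x. (m t x)\<^sup>2 / exp (- V x) \<partial>lborel) \<and>
     (\<forall>t>0. integrable lborel (\<lambda>x. deriv (\<lambda>s. (m s x)\<^sup>2 / exp (- V x)) t) \<and>
        ((\<lambda>s. \<integral>x. (m s x)\<^sup>2 / exp (- V x) \<partial>lborel) has_real_derivative
           (\<integral>x. deriv (\<lambda>s. (m s x)\<^sup>2 / exp (- V x)) t \<partial>lborel)) (at t))"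

definition no_boundary_terms ::
  "(real^'d \<Rightarrow> real) \<Rightarrow> (real^'d \<Rightarrow> real) \<Rightarrow> (real \<Rightarrow> real^'d \<Rightarrow> real) \<Rightarrow> bool" where
  "no_boundary_terms \<phi> V m \<longleftrightarrow>
     (\<forall>t>0. let u = (\<lambda>x. m t x / exp (- V x)); G = fp_flux \<phi> V (m t) in
        integrable lborel (\<lambda>x. u x * divergence G x) \<and>
        integrable lborel (\<lambda>x. grad u x \<bullet> G x) \<and>
        (\<integral>x. u x * divergence G x \<partial>lborel) = - (\<integral>x. grad u x \<bullet> G x \<partial>lborel))"

definition regular_law ::
  "(real^'d \<Rightarrow> real) \<Rightarrow> (real^'d \<Rightarrow> real) \<Rightarrow> (real \<Rightarrow> (real^'d) measure) \<Rightarrow> bool" where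
  "regular_law \<phi> V \<mu> \<longleftrightarrow>
     (\<exists>m. (\<forall>t>0. lebesgue_density (\<mu> t) (m t)) \<and>
        fokker_planck_solution \<phi> V (\<mu> 0) m \<and>
        (\<forall>m'. fokker_planck_solution \<phi> V (\<mu> 0) m' \<longrightarrow> (\<forall>t>0. m' t = m t)) \<and>
        (chi_square (\<mu> 0) (target V) < \<infinity> \<longrightarrow>
           lebesgue_density (\<mu> 0) (m 0) \<and>
           differentiable_under_integral V m \<and> no_boundary_terms \<phi> V m))"

end

theory Submission
  imports Defs
begin

text \<open>Let $u_t = d\mu_t / d\pi$. The Fokker--Planck flux is
  $e^{-V} (\nabla^2\phi)^{-1} \nabla u_t$, so differentiating under the integral sign and integrating
  by parts gives $\partial_t \chi^2(\mu_t\|\pi) = -2\,E_\pi\langle\nabla u_t, (\nabla^2\phi)^{-1}\nabla u_t\rangle$,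
  which the mirror Poincare inequality bounds by $-(2/C)\,\chi^2(\mu_t\|\pi)$; Gronwall's lemma gives
  the decay of $\chi^2$. Total variation, Hellinger distance and relative entropy are
  each dominated by $\chi^2$. The mirror Poincare inequality may be applied to $u_t$ because
  $\nabla u_t = e^{V} (\nabla^2\phi) G_t$ with a differentiable flux $G_t$, so that $u_t$ is
  continuously differentiable.\<close>

section \<open>Comparison of divergences\<close>

text \<open>The mass of \<open>Q\<close> gives E_P u = 1, so the variance of \<open>u\<close> under
  \<open>P\<close> is E_P u^2 - 1. Since \<open>u\<close> is a version of the Radon-Nikodym
  derivative, this number is the chi-square divergence, and entropy and total variation are both
  compared with it.\<close>

lemma density_ratio_bounds:
  fixes u :: "'a \<Rightarrow> real"
  assumes "prob_space P" and u [measurable]: "u \<in> borel_measurable P"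
    and nn: "\<And>x. 0 \<le> u x"
    and Q: "Q = density P (\<lambda>x. ennreal (u x))" and "prob_space Q"
    and sq: "integrable P (\<lambda>x. (u x)\<^sup>2)"
  shows integrable_density_ratio: "integrable P u"
    and integral_density_ratio: "(\<integral>x. u x \<partial>P) = 1"
    and integrable_ratio_minus_1_sq: "integrable P (\<lambda>x. (u x - 1)\<^sup>2)"
    and variance_density_ratio: "(\<integral>x. (u x - 1)\<^sup>2 \<partial>P) = (\<integral>x. (u x)\<^sup>2 \<partial>P) - 1"
    and chi_square_density: "chi_square Q P = ereal ((\<integral>x. (u x)\<^sup>2 \<partial>P) - 1)"
    and KL_div_le_chi_square: "KL_div Q P \<le> chi_square Q P"
    and TV_dist_le_chi_square: "ereal (2 * (TV_dist Q P)\<^sup>2) \<le> chi_square Q P"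
proof -
  interpret P: prob_space P by fact
  interpret Q: prob_space Q by fact

  \<comment> \<open>Moments of the density ratio\<close>
  have "1 = emeasure Q (space Q)" by (simp add: Q.emeasure_space_1)
  also have "\<dots> = (\<integral>\<^sup>+x. ennreal (u x) \<partial>P)"
    by (simp add: Q emeasure_density cong: nn_integral_cong)
  finally have nn1: "(\<integral>\<^sup>+x. ennreal (u x) \<partial>P) = 1" by simp
  show int: "integrable P u"
    using nn nn1 by (intro integrableI_nonneg) auto
  show one: "(\<integral>x. u x \<partial>P) = 1"
    using nn nn1 by (subst integral_eq_nn_integral) auto
  have expand: "(u x - 1)\<^sup>2 = (u x)\<^sup>2 - 2 * u x + 1" for x
    by (simp add: power2_eq_square algebra_simps)
  show int1: "integrable P (\<lambda>x. (u x - 1)\<^sup>2)"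
    unfolding expand using int sq by auto
  show var: "(\<integral>x. (u x - 1)\<^sup>2 \<partial>P) = (\<integral>x. (u x)\<^sup>2 \<partial>P) - 1"
    unfolding expand using int sq one by (simp add: P.prob_space)
  have ac: "absolutely_continuous P Q"
    unfolding Q by (rule absolutely_continuousI_density) measurable
  have RN: "AE x in P. ennreal (u x) = RN_deriv P Q x"
    by (rule P.RN_deriv_unique) (auto simp: Q)
  have "(\<integral>\<^sup>+x. (RN_deriv P Q x)\<^sup>2 \<partial>P) = (\<integral>\<^sup>+x. ennreal ((u x)\<^sup>2) \<partial>P)"
    using RN by (intro nn_integral_cong_AE) (auto elim!: eventually_mono simp: nn simp flip: ennreal_power)
  also have "\<dots> = ennreal (\<integral>x. (u x)\<^sup>2 \<partial>P)"
    using sq by (intro nn_integral_eq_integral) auto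
  finally show chi: "chi_square Q P = ereal ((\<integral>x. (u x)\<^sup>2 \<partial>P) - 1)"
    using ac by (simp add: chi_square_def enn2ereal_ennreal one_ereal_def)

  \<comment> \<open>Relative entropy\<close>
  have lower: "u x - 1 \<le> u x * ln (u x)" for x
  proof (cases "u x = 0")
    case False
    then have pos: "0 < u x" using nn[of x] by simp
    have "ln (1 / u x) \<le> 1 / u x - 1" using pos by (intro ln_le_minus_one) auto
    then have "u x * ln (1 / u x) \<le> u x * (1 / u x - 1)"
      using pos by (intro mult_left_mono) auto
    then show ?thesis using pos by (simp add: ln_div algebra_simps)
  qed simp
  have upper: "u x * ln (u x) \<le> (u x)\<^sup>2 - u x" for x
  proof (cases "u x = 0")
    case False
    then have pos: "0 < u x" using nn[of x] by simp
    have "u x * ln (u x) \<le> u x * (u x - 1)"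
      using pos by (intro mult_left_mono ln_le_minus_one) auto
    then show ?thesis by (simp add: power2_eq_square algebra_simps)
  qed simp
  \<comment> \<open>\<open>lower\<close> and \<open>upper\<close> are ln y \<le> y - 1 at y = 1/u
    and y = u; together they dominate |u ln u| by u^2 + u + 1. Integrability keeps
    \<open>KL_div\<close> away from its default value \<infinity>.\<close>
  have int_ent: "integrable P (\<lambda>x. u x * ln (u x))"
  proof (rule Bochner_Integration.integrable_bound)
    show "integrable P (\<lambda>x. (u x)\<^sup>2 + u x + 1)" using int sq by auto
    show "AE x in P. norm (u x * ln (u x)) \<le> norm ((u x)\<^sup>2 + u x + 1)"
    proof (intro AE_I2)
      fix x
      have "0 \<le> (u x)\<^sup>2" by simp
      then show "norm (u x * ln (u x)) \<le> norm ((u x)\<^sup>2 + u x + 1)"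
        using lower[of x] upper[of x] nn[of x] unfolding real_norm_def by linarith
    qed
  qed measurable
  have log_exp: "log (exp 1) y = ln y" for y :: real by (simp add: log_def)
  have eq: "AE x in P. u x * entropy_density (exp 1) P Q x = u x * ln (u x)"
    using RN
  proof (elim eventually_mono)
    fix x assume "ennreal (u x) = RN_deriv P Q x"
    then have "enn2real (RN_deriv P Q x) = u x"
      by (metis enn2real_ennreal nn)
    then show "u x * entropy_density (exp 1) P Q x = u x * ln (u x)"
      by (simp add: entropy_density_def log_exp)
  qed
  have "integrable P (\<lambda>x. u x * entropy_density (exp 1) P Q x)"
    using int_ent eq by (subst integrable_cong_AE[OF _ _ eq]) auto
  then have "integrable Q (entropy_density (exp 1) P Q)"
    unfolding Q by (subst integrable_real_density) (auto simp: nn)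
  moreover have "KL_divergence (exp 1) P Q = (\<integral>x. u x * ln (u x) \<partial>P)"
    unfolding Q by (subst P.KL_density) (auto simp: nn log_exp)
  ultimately have KL: "KL_div Q P = ereal (\<integral>x. u x * ln (u x) \<partial>P)"
    using ac by (simp add: KL_div_def)
  \<comment> \<open>The bound integrates to E u^2 - E u, which is the chi-square divergence because
    E u = 1.\<close>
  have "(\<integral>x. u x * ln (u x) \<partial>P) \<le> (\<integral>x. (u x)\<^sup>2 - u x \<partial>P)"
    using int sq int_ent upper by (intro integral_mono) auto
  then show "KL_div Q P \<le> chi_square Q P"
    unfolding KL chi using int sq one by simp

  \<comment> \<open>Total variation\<close>
  define \<kappa> where "\<kappa> = (\<integral>x. (u x - 1)\<^sup>2 \<partial>P)"
  have bound: "\<bar>measure Q A - measure P A\<bar> \<le> sqrt (\<kappa> / 2)" if A [measurable]: "A \<in> sets P" for A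
  proof -
    define \<delta> where "\<delta> = measure Q A - measure P A"
    \<comment> \<open>Testing against the sign function \<sigma> rather than the indicator of A yields
      4 \<delta>^2 \<le> \<kappa> instead of \<delta>^2 \<le> \<kappa>.\<close>
    define \<sigma> where "\<sigma> = (\<lambda>x. 2 * indicator A x - 1 :: real)"
    have "ennreal (measure Q A) = emeasure Q A" by (simp add: Q.emeasure_eq_measure)
    also have "\<dots> = (\<integral>\<^sup>+x. ennreal (u x * indicator A x) \<partial>P)"
      unfolding Q by (subst emeasure_density)
        (auto intro!: nn_integral_cong simp: indicator_def)
    also have "\<dots> = ennreal (\<integral>x. u x * indicator A x \<partial>P)"
      using nn int A by (intro nn_integral_eq_integral integrable_real_mult_indicator) auto
    finally have QA: "measure Q A = (\<integral>x. u x * indicator A x \<partial>P)"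
      using nn by (simp add: integral_nonneg_AE)
    have intA: "integrable P (\<lambda>x. u x * indicator A x)"
      using int A by (intro integrable_real_mult_indicator) auto
    have intA': "integrable P (indicator A :: 'a \<Rightarrow> real)"
      by (intro integrable_real_indicator) (simp_all add: P.emeasure_eq_measure)
    \<comment> \<open>Cauchy-Schwarz by completing the square: \<sigma>^2 = 1 and
      E_P[(u - 1) \<sigma>] = 2 \<delta>, so 2 \<delta> \<sigma> is the L^2(P) projection of u - 1
      onto \<sigma>, and the remainder has squared norm \<kappa> - 4 \<delta>^2.\<close>
    have sq_expand: "((u x - 1) - 2 * \<delta> * \<sigma> x)\<^sup>2 =
        (u x - 1)\<^sup>2 - 4 * \<delta> * (2 * (u x * indicator A x) - u x - 2 * indicator A x + 1) + 4 * \<delta>\<^sup>2" for x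
      by (cases "x \<in> A") (simp_all add: \<sigma>_def power2_eq_square algebra_simps)
    have "0 \<le> (\<integral>x. ((u x - 1) - 2 * \<delta> * \<sigma> x)\<^sup>2 \<partial>P)" by simp
    also have "\<dots> = \<kappa> - 4 * \<delta> * (2 * measure Q A - 1 - 2 * measure P A + 1) + 4 * \<delta>\<^sup>2"
      unfolding sq_expand \<kappa>_def QA using int1 intA intA' int one
      by (simp add: P.prob_space)
    also have "\<dots> = \<kappa> - 4 * \<delta>\<^sup>2"
      by (simp add: \<delta>_def power2_eq_square algebra_simps)
    \<comment> \<open>Weakened from \<kappa>/4 to \<kappa>/2, the form that twice the squared
      distance asks for.\<close>
    finally have "\<delta>\<^sup>2 \<le> \<kappa> / 2" using zero_le_power2[of \<delta>] by linarith
    then show ?thesis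
      unfolding \<delta>_def[symmetric] by (intro real_le_rsqrt) simp
  qed
  have ne: "sets P \<noteq> {}" by auto
  have "TV_dist Q P \<le> sqrt (\<kappa> / 2)"
    unfolding TV_dist_def using ne bound by (rule cSUP_least)
  \<comment> \<open>Squaring preserves the bound only for a nonnegative supremum; the empty set
    contributes 0, and \<open>bound\<close> makes the supremum genuine.\<close>
  moreover have "0 \<le> TV_dist Q P"
    unfolding TV_dist_def
    by (rule cSUP_upper2[where x = "{}"]) (auto intro!: bdd_aboveI2 bound)
  ultimately have "(TV_dist Q P)\<^sup>2 \<le> (sqrt (\<kappa> / 2))\<^sup>2" by (intro power_mono)
  also have "\<dots> = \<kappa> / 2" by (simp add: \<kappa>_def)
  finally show "ereal (2 * (TV_dist Q P)\<^sup>2) \<le> chi_square Q P"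
    unfolding chi using var by (simp add: \<kappa>_def)
qed

text \<open>The quotient u = m/p is the density of \<mu> with respect to \<pi>, and the integral of
  m^2/p is E_\<pi> u^2, so the previous comparison applies to \<open>u\<close>. Hellinger distance
  is treated here because it is expressed through Lebesgue densities.\<close>

lemma lebesgue_density_ratio:
  fixes m p :: "real^'d \<Rightarrow> real"
  assumes m: "lebesgue_density \<mu> m" and p: "lebesgue_density \<pi> p" and pos: "\<And>x. 0 < p x"
    and "prob_space \<mu>" "prob_space \<pi>" and sq: "integrable lborel (\<lambda>x. (m x)\<^sup>2 / p x)"
  shows hellinger_sq_le_chi_square: "hellinger_sq \<mu> \<pi> \<le> chi_square \<mu> \<pi>"
    and chi_square_lebesgue_density: "chi_square \<mu> \<pi> = ereal ((\<integral>x. (m x)\<^sup>2 / p x \<partial>lborel) - 1)"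
    and density_of_lebesgue_density: "\<mu> = density \<pi> (\<lambda>x. ennreal (m x / p x))"
    and integrable_ratio_sq: "integrable \<pi> (\<lambda>x. (m x / p x)\<^sup>2)"
proof -
  have [measurable]: "m \<in> borel_measurable borel" "p \<in> borel_measurable borel"
    and nn: "\<And>x. 0 \<le> m x" and \<mu>: "\<mu> = density lborel (\<lambda>x. ennreal (m x))"
    and \<pi>: "\<pi> = density lborel (\<lambda>x. ennreal (p x))"
    using m p by (auto simp: lebesgue_density_def)
  have p0: "p x \<noteq> 0" for x using pos[of x] by simp
  have unn: "0 \<le> m x / p x" for x using nn[of x] pos[of x] by simp
  show Q: "\<mu> = density \<pi> (\<lambda>x. ennreal (m x / p x))"
    unfolding \<mu> \<pi> using p0 pos unn less_imp_le[OF pos]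
    by (subst density_density_eq) (auto intro!: density_cong simp: ennreal_mult'[symmetric])
  have um: "(\<lambda>x. m x / p x) \<in> borel_measurable \<pi>" by (simp add: \<pi>)
  show sq\<pi>: "integrable \<pi> (\<lambda>x. (m x / p x)\<^sup>2)"
    unfolding \<pi> using sq less_imp_le[OF pos]
    by (subst integrable_real_density) (auto simp: power2_eq_square p0 field_simps)
  have transfer: "(\<integral>x. (m x / p x)\<^sup>2 \<partial>\<pi>) = (\<integral>x. (m x)\<^sup>2 / p x \<partial>lborel)"
    unfolding \<pi> using less_imp_le[OF pos]
    by (subst integral_real_density) (auto simp: power2_eq_square p0 field_simps)
  note ratio = \<open>prob_space \<pi>\<close> um unn Q \<open>prob_space \<mu>\<close> sq\<pi>
  show chi: "chi_square \<mu> \<pi> = ereal ((\<integral>x. (m x)\<^sup>2 / p x \<partial>lborel) - 1)"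
    using chi_square_density[OF ratio] by (simp add: transfer)
  have RN: "AE x in lborel. ennreal (m x) = RN_deriv lborel \<mu> x"
    "AE x in lborel. ennreal (p x) = RN_deriv lborel \<pi> x"
    by (rule sigma_finite_measure.RN_deriv_unique[OF sigma_finite_lborel]; simp add: \<mu> \<pi>)+
  \<comment> \<open>From m - p = (sqrt m - sqrt p)(sqrt m + sqrt p) and sqrt m + sqrt p \<ge> sqrt
    p. The Lebesgue integral of the right-hand side is the variance of m/p under \<pi>.\<close>
  have le: "(sqrt (m x) - sqrt (p x))\<^sup>2 \<le> p x * (m x / p x - 1)\<^sup>2" for x
  proof -
    have "sqrt (p x) * \<bar>sqrt (m x) - sqrt (p x)\<bar> \<le> (sqrt (m x) + sqrt (p x)) * \<bar>sqrt (m x) - sqrt (p x)\<bar>"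
      using nn[of x] by (intro mult_right_mono) auto
    also have "\<dots> = \<bar>(sqrt (m x) + sqrt (p x)) * (sqrt (m x) - sqrt (p x))\<bar>"
      using nn[of x] pos[of x] by (simp add: abs_mult)
    also have "\<dots> = \<bar>m x - p x\<bar>"
      using nn[of x] pos[of x] by (simp add: algebra_simps)
    finally have "(sqrt (p x) * \<bar>sqrt (m x) - sqrt (p x)\<bar>)\<^sup>2 \<le> \<bar>m x - p x\<bar>\<^sup>2"
      using pos[of x] by (intro power_mono) auto
    then have "p x * (sqrt (m x) - sqrt (p x))\<^sup>2 \<le> (m x - p x)\<^sup>2"
      using pos[of x] by (simp add: power_mult_distrib)
    then have "(sqrt (m x) - sqrt (p x))\<^sup>2 \<le> (m x - p x)\<^sup>2 / p x"
      using pos[of x] by (simp add: pos_le_divide_eq mult.commute)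
    also have "\<dots> = p x * (m x / p x - 1)\<^sup>2"
      using pos[of x] by (simp add: power2_eq_square field_simps)
    finally show ?thesis .
  qed
  have "(\<integral>\<^sup>+x. ennreal ((sqrt (enn2real (RN_deriv lborel \<mu> x))
      - sqrt (enn2real (RN_deriv lborel \<pi> x)))\<^sup>2) \<partial>lborel)
      \<le> (\<integral>\<^sup>+x. ennreal (p x * (m x / p x - 1)\<^sup>2) \<partial>lborel)"
  proof (rule nn_integral_mono_AE, use RN in eventually_elim)
    case (elim x)
    then have "enn2real (RN_deriv lborel \<mu> x) = m x" "enn2real (RN_deriv lborel \<pi> x) = p x"
      by (metis enn2real_ennreal nn, metis enn2real_ennreal less_imp_le pos)
    then show ?case using le[of x] by (simp add: ennreal_leI)
  qed
  also have "\<dots> = (\<integral>\<^sup>+x. ennreal ((m x / p x - 1)\<^sup>2) \<partial>\<pi>)"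
    unfolding \<pi> using less_imp_le[OF pos]
    by (subst nn_integral_density) (auto simp: ennreal_mult)
  also have "\<dots> = ennreal (\<integral>x. (m x / p x - 1)\<^sup>2 \<partial>\<pi>)"
    using integrable_ratio_minus_1_sq[OF ratio] by (intro nn_integral_eq_integral) auto
  also have "\<dots> = ennreal ((\<integral>x. (m x / p x)\<^sup>2 \<partial>\<pi>) - 1)"
    using variance_density_ratio[OF ratio] by simp
  finally have "hellinger_sq \<mu> \<pi> \<le> enn2ereal (ennreal ((\<integral>x. (m x / p x)\<^sup>2 \<partial>\<pi>) - 1))"
    unfolding hellinger_sq_def by (simp add: less_eq_ennreal.rep_eq)
  also have "\<dots> = chi_square \<mu> \<pi>"
  proof -
    \<comment> \<open>\<open>ennreal\<close> truncates negative reals to 0; nonnegativity of the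
      variance shows that nothing is lost.\<close>
    have "0 \<le> (\<integral>x. (m x / p x - 1)\<^sup>2 \<partial>\<pi>)" by simp
    then show ?thesis
      using variance_density_ratio[OF ratio] chi_square_density[OF ratio]
      by (simp add: enn2ereal_ennreal)
  qed
  finally show "hellinger_sq \<mu> \<pi> \<le> chi_square \<mu> \<pi>" .
qed

section \<open>Gradients and Hessians\<close>

lemma has_derivative_grad:
  fixes f :: "real^'d \<Rightarrow> real"
  assumes "f differentiable at x"
  shows "(f has_derivative (\<lambda>h. grad f x \<bullet> h)) (at x)"
proof -
  have D: "(f has_derivative frechet_derivative f (at x)) (at x)"
    using assms frechet_derivative_works by blast
  interpret linear "frechet_derivative f (at x)"
    using D by (rule has_derivative_linear)
  have "frechet_derivative f (at x) h = grad f x \<bullet> h" for h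
  proof -
    have "frechet_derivative f (at x) h = frechet_derivative f (at x) (\<Sum>i\<in>UNIV. (h $ i) *\<^sub>R axis i 1)"
      by (simp add: basis_expansion flip: scalar_mult_eq_scaleR)
    also have "\<dots> = grad f x \<bullet> h"
      by (simp add: sum scaleR grad_def inner_vec_def mult.commute)
    finally show ?thesis .
  qed
  then have "frechet_derivative f (at x) = (\<lambda>h. grad f x \<bullet> h)" by auto
  then show ?thesis using D by simp
qed

lemma grad_eqI:
  fixes f :: "real^'d \<Rightarrow> real"
  assumes "(f has_derivative (\<lambda>h. g \<bullet> h)) (at x)"
  shows "grad f x = g"
proof -
  have "frechet_derivative f (at x) = (\<lambda>h. g \<bullet> h)"
    using frechet_derivative_at[OF assms] by simp
  then show ?thesis
    by (simp add: grad_def inner_axis vec_eq_iff)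
qed

text \<open>A continuous gradient is bounded on the compact unit ball around a point, and the mean
  value inequality on this convex set makes the bound a Lipschitz constant. This admits the density
  ratio as a test function in \<open>mirror_poincare\<close>.\<close>

lemma local_lipschitz_of_continuous_grad:
  fixes u :: "real^'d \<Rightarrow> real"
  assumes diff: "\<And>x. u differentiable at x" and cont: "continuous_on UNIV (grad u)"
  shows "local_lipschitz T UNIV (\<lambda>_. u)"
proof (rule local_lipschitzI)
  fix t x
  have "compact (grad u ` cball x 1)"
    by (intro compact_continuous_image continuous_on_subset[OF cont]) auto
  then have "bounded (grad u ` cball x 1)" by (rule compact_imp_bounded)
  then obtain L where L: "\<And>y. y \<in> cball x 1 \<Longrightarrow> norm (grad u y) \<le> L"
    unfolding bounded_iff by (metis imageI)
  have "0 \<le> norm (grad u x)" by simp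
  also have "\<dots> \<le> L" by (rule L) simp
  finally have "0 \<le> L" .
  have "L-lipschitz_on (cball x 1) u"
  proof (rule bounded_derivative_imp_lipschitz)
    fix y assume y: "y \<in> cball x 1"
    show "(u has_derivative (\<lambda>h. grad u y \<bullet> h)) (at y within cball x 1)"
      using has_derivative_grad[OF diff] by (rule has_derivative_at_withinI)
    show "onorm (\<lambda>h. grad u y \<bullet> h) \<le> L"
    proof (rule onorm_le)
      fix h
      have "norm (grad u y \<bullet> h) \<le> norm (grad u y) * norm h"
        using Cauchy_Schwarz_ineq2 by simp
      also have "\<dots> \<le> L * norm h" using L[OF y] by (intro mult_right_mono) auto
      finally show "norm (grad u y \<bullet> h) \<le> L * norm h" .
    qed
  qed (use \<open>0 \<le> L\<close> in auto)
  then show "\<exists>r>0. \<exists>L. \<forall>s\<in>cball t r \<inter> T. L-lipschitz_on (cball x r \<inter> UNIV) u"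
    by (intro exI[of _ 1]) auto
qed

lemma has_derivative_hess:
  assumes "grad f differentiable at x"
  shows "(grad f has_derivative (\<lambda>h. hess f x *v h)) (at x)"
  using assms unfolding hess_def jacobian_works .

text \<open>Add the two tangent inequalities at \<open>x\<close> and at \<open>y\<close>. Each
  follows by restricting \<open>f\<close> to the line through the two points, where it is a convex
  function of one variable.\<close>

lemma grad_monotone:
  fixes f :: "real^'d \<Rightarrow> real"
  assumes conv: "strictly_convex_on UNIV f" and diff: "\<And>x. f differentiable at x"
  shows "0 \<le> (grad f y - grad f x) \<bullet> (y - x)"
proof -
  have above: "grad f a \<bullet> (b - a) \<le> f b - f a" for a b
  proof -
    define h where "h s = f (a + s *\<^sub>R (b - a))" for s
    have "convex_on UNIV h"
    proof (rule convex_onI)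
      fix s r q :: real assume s: "0 < s" "s < 1"
      let ?r = "a + r *\<^sub>R (b - a)" and ?q = "a + q *\<^sub>R (b - a)"
      have eq: "a + ((1 - s) *\<^sub>R r + s *\<^sub>R q) *\<^sub>R (b - a) = (1 - s) *\<^sub>R ?r + s *\<^sub>R ?q"
        by (simp add: algebra_simps)
      show "h ((1 - s) *\<^sub>R r + s *\<^sub>R q) \<le> (1 - s) * h r + s * h q"
      \<comment> \<open>Strict convexity speaks of distinct points only; coinciding points give
        equality.\<close>
      proof (cases "?r = ?q")
        case True
        have comb: "(1 - s) *\<^sub>R z + s *\<^sub>R z = z" for z :: "real^'d"
          by (simp flip: scaleR_add_left)
        show ?thesis unfolding h_def eq True comb by (simp add: algebra_simps)
      next
        case False
        then show ?thesis
          using conv s unfolding h_def eq strictly_convex_on_def by (simp add: less_imp_le)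
      qed
    qed simp
    moreover have "(h has_field_derivative grad f a \<bullet> (b - a)) (at 0)"
    proof -
      have f: "(f has_derivative (\<lambda>h. grad f a \<bullet> h)) (at (a + 0 *\<^sub>R (b - a)))"
        using has_derivative_grad[OF diff] by simp
      have "((\<lambda>s. a + s *\<^sub>R (b - a)) has_derivative (\<lambda>s. s *\<^sub>R (b - a))) (at 0)"
        by (auto intro!: derivative_eq_intros)
      from has_derivative_compose[OF this f] show ?thesis
        unfolding has_field_derivative_def h_def
        by (simp add: mult_commute_abs)
    qed
    ultimately have "h 1 - h 0 \<ge> (grad f a \<bullet> (b - a)) * (1 - 0)"
      by (intro convex_on_imp_above_tangent[where A = UNIV]) auto
    then show ?thesis by (simp add: h_def)
  qed
  show ?thesis
    using above[of x y] above[of y x] by (simp add: inner_diff_left inner_diff_right)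
qed

text \<open>A negative value would be a negative derivative at 0 of the gradient's component along
  \<open>v\<close> on the line from \<open>x\<close> in direction \<open>v\<close>; that component
  would then decrease just to the right of 0, against monotonicity of the gradient.\<close>

lemma hess_nonneg:
  fixes f :: "real^'d \<Rightarrow> real"
  assumes conv: "strictly_convex_on UNIV f" and diff: "\<And>x. f differentiable at x"
    and "grad f differentiable at x"
  shows "0 \<le> v \<bullet> (hess f x *v v)"
proof (rule ccontr)
  assume neg: "\<not> ?thesis"
  define k where "k s = grad f (x + s *\<^sub>R v) \<bullet> v" for s
  have "(grad f has_derivative (\<lambda>h. hess f x *v h)) (at (x + 0 *\<^sub>R v))"
    using has_derivative_hess assms(3) by simp
  moreover have "((\<lambda>s. x + s *\<^sub>R v) has_derivative (\<lambda>s. s *\<^sub>R v)) (at 0)"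
    by (auto intro!: derivative_eq_intros)
  ultimately have "((\<lambda>s. grad f (x + s *\<^sub>R v)) has_derivative (\<lambda>s. hess f x *v (s *\<^sub>R v))) (at 0)"
    by (rule has_derivative_compose[rotated])
  from has_derivative_inner_left[OF this, of v]
  have "(k has_field_derivative v \<bullet> (hess f x *v v)) (at 0)"
    unfolding has_field_derivative_def k_def
    by (simp add: matrix_vector_mult_scaleR inner_commute mult_commute_abs)
  then obtain d where d: "0 < d" "\<And>h. 0 < h \<Longrightarrow> h < d \<Longrightarrow> k (0 + h) < k 0"
    using DERIV_neg_dec_right[of k _ 0] neg by (metis not_le)
  have "0 \<le> (grad f (x + (d / 2) *\<^sub>R v) - grad f x) \<bullet> ((d / 2) *\<^sub>R v)"
    using grad_monotone[OF conv diff, of "x + (d / 2) *\<^sub>R v" x] by simp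
  then have "k 0 \<le> k (d / 2)"
    using d(1) by (simp add: k_def inner_diff_left zero_le_mult_iff)
  then show False using d(2)[of "d / 2"] d(1) by simp
qed

lemma matrix_inv_cancel:
  fixes A :: "real^'n^'n"
  assumes "invertible A"
  shows "A *v (matrix_inv A *v v) = v"
proof -
  have "A ** matrix_inv A = mat 1"
    using assms someI_ex[of "\<lambda>B. A ** B = mat 1 \<and> B ** A = mat 1"]
    unfolding invertible_def matrix_inv_def by blast
  then show ?thesis by (simp add: matrix_vector_mul_assoc)
qed

text \<open>With v = A w the form becomes (A w) \<bullet> w, so symmetry of \<open>A\<close> does
  not enter.\<close>

lemma matrix_inv_nonneg:
  fixes A :: "real^'n^'n"
  assumes "invertible A" and psd: "\<And>v. 0 \<le> v \<bullet> (A *v v)"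
  shows "0 \<le> v \<bullet> (matrix_inv A *v v)"
  using psd[of "matrix_inv A *v v"] by (simp add: matrix_inv_cancel[OF assms(1)] inner_commute)

lemma continuous_on_matrix_vector_mult:
  fixes A :: "'a::topological_space \<Rightarrow> real^'n^'m"
  assumes "continuous_on S A" and "continuous_on S v"
  shows "continuous_on S (\<lambda>x. A x *v v x)"
  unfolding matrix_vector_mult_def using assms by (intro continuous_intros)

section \<open>Decay of the chi-square divergence\<close>

text \<open>Since grad ln u = grad u / u and m = u exp(-V), the factor \<open>u\<close> cancels. The
  flux becomes linear in the gradient of \<open>u\<close>, with the density of the target as
  weight.\<close>

lemma fp_flux_eq:
  fixes m V :: "real^'d \<Rightarrow> real"
  assumes "V differentiable at x" and "m differentiable at x" and pos: "\<And>x. 0 < m x"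
  defines "u \<equiv> \<lambda>y. m y / exp (- V y)"
  shows "u differentiable at x"
    and "fp_flux \<phi> V m x = exp (- V x) *\<^sub>R (matrix_inv (hess \<phi> x) *v grad u x)"
proof -
  have "(\<lambda>y. exp (- V y)) differentiable at x"
  proof -
    have "((\<lambda>y. exp (- V y)) has_derivative (\<lambda>h. exp (- V x) * - (grad V x \<bullet> h))) (at x)"
      by (auto intro!: derivative_eq_intros has_derivative_grad[OF assms(1)])
    then show ?thesis by (rule differentiableI)
  qed
  with assms(2) show diff: "u differentiable at x"
    unfolding u_def by (intro differentiable_divide) auto
  have "0 < u x" by (simp add: u_def pos)
  then have "((\<lambda>y. ln (u y)) has_derivative (\<lambda>h. (inverse (u x) *\<^sub>R grad u x) \<bullet> h)) (at x)"
    by (auto intro!: derivative_eq_intros has_derivative_grad[OF diff] simp: field_simps)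
  from grad_eqI[OF this] have "grad (\<lambda>y. ln (u y)) x = inverse (u x) *\<^sub>R grad u x" .
  then show "fp_flux \<phi> V m x = exp (- V x) *\<^sub>R (matrix_inv (hess \<phi> x) *v grad u x)"
    using pos[of x] unfolding fp_flux_def
    by (simp add: u_def matrix_vector_mult_scaleR)
qed

text \<open>The function exp(c s) f(s) is nonincreasing. Derivatives are taken only at positive
  times, and continuity covers time 0, where the derivative of the chi-square divergence may be
  infinite.\<close>

lemma gronwall_decay:
  fixes f f' :: "real \<Rightarrow> real"
  assumes "0 \<le> t" and cont: "continuous_on {0..} f"
    and deriv: "\<And>s. 0 < s \<Longrightarrow> (f has_real_derivative f' s) (at s)"
    and le: "\<And>s. 0 < s \<Longrightarrow> f' s \<le> - c * f s"
  shows "f t \<le> exp (- c * t) * f 0"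
proof -
  define g where "g s = exp (c * s) * f s" for s :: real
  have "g t \<le> g 0"
  proof (rule DERIV_nonpos_imp_decreasing_open[OF \<open>0 \<le> t\<close>])
    show "continuous_on {0..t} g"
      unfolding g_def by (intro continuous_intros continuous_on_subset[OF cont]) auto
    fix s :: real assume s: "0 < s"
    have "(g has_real_derivative exp (c * s) * (c * f s + f' s)) (at s)"
      unfolding g_def by (auto intro!: derivative_eq_intros deriv[OF s] simp: algebra_simps)
    moreover have "exp (c * s) * (c * f s + f' s) \<le> 0"
      using le[OF s] by (intro mult_nonneg_nonpos) auto
    ultimately show "\<exists>y. (g has_real_derivative y) (at s) \<and> y \<le> 0" by blast
  qed
  then have "exp (- c * t) * g t \<le> exp (- c * t) * g 0" by (intro mult_left_mono) auto
  then show ?thesis by (simp add: g_def exp_minus field_simps)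
qed

lemma prob_space_law:
  assumes "mirror_langevin_diffusion M F B \<phi> V X Y" and "0 \<le> t"
  shows "prob_space (law M X t)"
proof -
  interpret prob_space M
    using assms(1) by (simp add: mirror_langevin_diffusion_def brownian_motion_def)
  have "subalgebra M (F t)" "X t \<in> borel_measurable (F t)"
    using assms by (auto simp: mirror_langevin_diffusion_def brownian_motion_def)
  then have "X t \<in> borel_measurable M" by (rule measurable_from_subalg)
  then show ?thesis unfolding law_def by (rule prob_space_distr)
qed

lemma chi_square_decay:
  fixes V \<phi> :: "real^'d \<Rightarrow> real" and m :: "real \<Rightarrow> real^'d \<Rightarrow> real"
  assumes V: "\<And>x. V differentiable at x"
    and \<pi>: "prob_space (target V)"
    and \<phi>: "mirror_map \<phi>" and inv: "\<And>x. invertible (hess \<phi> x)"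
    and dens: "\<And>t. 0 \<le> t \<Longrightarrow> lebesgue_density (\<mu> t) (m t)"
    and prob: "\<And>t. 0 \<le> t \<Longrightarrow> prob_space (\<mu> t)"
    and fp: "fokker_planck_solution \<phi> V \<mu>\<^sub>0 m"
    and diff: "differentiable_under_integral V m" and nb: "no_boundary_terms \<phi> V m"
    and C: "0 < C" and mp: "mirror_poincare \<phi> V C" and t: "0 \<le> t"
  shows "(\<integral>x. (m t x)\<^sup>2 / exp (- V x) \<partial>lborel) - 1
    \<le> exp (- 2 * t / C) * ((\<integral>x. (m 0 x)\<^sup>2 / exp (- V x) \<partial>lborel) - 1)"
proof -
  \<comment> \<open>\<open>E s - 1\<close> is the chi-square divergence at time \<open>s\<close>;
    \<open>D s\<close> is the mirror Dirichlet energy of the density ratio, with the weight exp(-V)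
    absorbed into the flux.\<close>
  define E where "E s = (\<integral>x. (m s x)\<^sup>2 / exp (- V x) \<partial>lborel)" for s
  define D where "D s = (\<integral>x. grad (\<lambda>y. m s y / exp (- V y)) x \<bullet> fp_flux \<phi> V (m s) x \<partial>lborel)" for s
  have Vc: "continuous_on UNIV V"
    using V by (simp add: differentiable_imp_continuous_on differentiable_at_imp_differentiable_on)
  then have [measurable]: "V \<in> borel_measurable borel"
    by (rule borel_measurable_continuous_onI)
  have tgt: "lebesgue_density (target V) (\<lambda>x. exp (- V x))"
    by (auto simp: lebesgue_density_def target_def)
  have key: "(E has_real_derivative - 2 * D s) (at s) \<and> E s - 1 \<le> C * D s" if s: "0 < s" for s
  proof -
    define u where "u = (\<lambda>x. m s x / exp (- V x))"
    define G where "G = fp_flux \<phi> V (m s)"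
    have pos: "0 < m s x" and md: "m s differentiable at x" and Gd: "G differentiable at x"
      and dm: "((\<lambda>s. m s x) has_real_derivative divergence G x) (at s)" for x
      using fp s unfolding fokker_planck_solution_def G_def by auto
    have ud: "u differentiable at x"
      and G_eq: "G x = exp (- V x) *\<^sub>R (matrix_inv (hess \<phi> x) *v grad u x)" for x
      using fp_flux_eq[OF V md pos] unfolding u_def G_def by auto
    have gu: "grad u = (\<lambda>x. exp (V x) *\<^sub>R (hess \<phi> x *v G x))"
      by (simp add: fun_eq_iff G_eq matrix_vector_mult_scaleR matrix_inv_cancel[OF inv] flip: exp_add)
    have hc: "continuous_on UNIV (hess \<phi>)" and \<phi>d: "\<And>x. \<phi> differentiable at x"
      and \<phi>d2: "\<And>x. grad \<phi> differentiable at x" and conv: "strictly_convex_on UNIV \<phi>"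
      using \<phi> by (auto simp: mirror_map_def twice_continuously_differentiable_def)
    have "continuous_on UNIV G"
      using Gd by (simp add: differentiable_imp_continuous_on differentiable_at_imp_differentiable_on)
    then have "continuous_on UNIV (grad u)"
      unfolding gu by (intro continuous_intros continuous_on_matrix_vector_mult hc Vc)
    then have lip: "local_lipschitz {0::real} UNIV (\<lambda>_. u)"
      by (intro local_lipschitz_of_continuous_grad ud)
    \<comment> \<open>Chain rule in time, with the time derivative of \<open>m\<close> replaced by
      the divergence of the flux through the Fokker-Planck equation.\<close>
    have dv: "deriv (\<lambda>s. (m s x)\<^sup>2 / exp (- V x)) s = 2 * (u x * divergence G x)" for x
      by (rule DERIV_imp_deriv)
        (auto intro!: derivative_eq_intros dm simp: u_def field_simps)
    have nb': "integrable lborel (\<lambda>x. u x * divergence G x)"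
      "integrable lborel (\<lambda>x. grad u x \<bullet> G x)"
      "(\<integral>x. u x * divergence G x \<partial>lborel) = - (\<integral>x. grad u x \<bullet> G x \<partial>lborel)"
      using nb s unfolding no_boundary_terms_def u_def G_def Let_def by auto
    have "(E has_real_derivative
        (\<integral>x. deriv (\<lambda>s. (m s x)\<^sup>2 / exp (- V x)) s \<partial>lborel)) (at s)"
      using diff s unfolding differentiable_under_integral_def E_def[abs_def] by auto
    also have "(\<integral>x. deriv (\<lambda>s. (m s x)\<^sup>2 / exp (- V x)) s \<partial>lborel) = - 2 * D s"
      unfolding dv D_def u_def[symmetric] G_def[symmetric] using nb'(3) by simp
    finally have 1: "(E has_real_derivative - 2 * D s) (at s)" .

    have sq: "integrable lborel (\<lambda>x. (m s x)\<^sup>2 / exp (- V x))"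
      using diff s unfolding differentiable_under_integral_def by simp
    have ps: "prob_space (\<mu> s)" and ds: "lebesgue_density (\<mu> s) (m s)"
      using prob dens s by auto
    note h = lebesgue_density_ratio[OF ds tgt exp_gt_zero ps \<pi> sq, folded u_def]
    have [measurable]: "m s \<in> borel_measurable borel"
      using ds by (simp add: lebesgue_density_def)
    have um: "u \<in> borel_measurable (target V)"
      by (simp add: u_def target_def)
    have unn: "0 \<le> u x" for x using pos[of x] by (simp add: u_def)
    have u_sq: "integrable (target V) (\<lambda>x. (u x)\<^sup>2)"
      using h(4) by (simp add: u_def)
    have ratio: "\<mu> s = density (target V) (\<lambda>x. ennreal (u x))"
      using h(3) by (simp add: u_def)
    note r = \<pi> um unn ratio ps u_sq
    \<comment> \<open>Two evaluations of the same divergence are equated, one with the ratio under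
      the target and one with Lebesgue densities.\<close>
    have var: "(\<integral>x. (u x - 1)\<^sup>2 \<partial>target V) = E s - 1"
      using variance_density_ratio[OF r] chi_square_density[OF r] h(2) by (simp add: E_def)
    \<comment> \<open>The Poincare inequality bounds the variance by an integral of
      \<open>ennreal\<close> values; nonnegativity makes it the true energy rather than that of the
      positive part.\<close>
    have psd: "0 \<le> grad u x \<bullet> (matrix_inv (hess \<phi> x) *v grad u x)" for x
      by (intro matrix_inv_nonneg inv hess_nonneg conv \<phi>d \<phi>d2)
    \<comment> \<open>Inherited from the integrable function \<open>grad u x \<bullet> G x\<close>,
      so measurability of the inverse Hessian need not be addressed.\<close>
    have [measurable]: "(\<lambda>x. grad u x \<bullet> (matrix_inv (hess \<phi> x) *v grad u x)) \<in> borel_measurable borel"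
    proof -
      have "(\<lambda>x. grad u x \<bullet> (matrix_inv (hess \<phi> x) *v grad u x)) = (\<lambda>x. exp (V x) * (grad u x \<bullet> G x))"
        by (simp add: fun_eq_iff G_eq flip: exp_add mult.assoc)
      then show ?thesis using borel_measurable_integrable[OF nb'(2)] by simp
    qed
    have "(\<integral>\<^sup>+x. ennreal (grad u x \<bullet> (matrix_inv (hess \<phi> x) *v grad u x)) \<partial>target V)
        = (\<integral>\<^sup>+x. ennreal (grad u x \<bullet> G x) \<partial>lborel)"
      unfolding target_def by (subst nn_integral_density)
        (auto simp: G_eq psd ennreal_mult)
    also have "\<dots> = ennreal (D s)"
      unfolding D_def u_def[symmetric] G_def[symmetric]
      by (intro nn_integral_eq_integral nb') (simp add: G_eq psd)
    finally have "ennreal (E s - 1) \<le> ennreal C * ennreal (D s)"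
      using mp[unfolded mirror_poincare_def, rule_format, OF conjI[OF lip u_sq]]
      by (simp only: integral_density_ratio[OF r] var)
    moreover have D0: "0 \<le> D s"
      unfolding D_def u_def[symmetric] G_def[symmetric]
      by (intro integral_nonneg_AE) (simp add: G_eq psd)
    ultimately have "E s - 1 \<le> C * D s"
      using C by (simp add: ennreal_le_iff flip: ennreal_mult)
    with 1 show ?thesis by blast
  qed
  \<comment> \<open>The rate 2/C combines the factor 2 from differentiating the square with E - 1
    \<le> C D.\<close>
  have "E t - 1 \<le> exp (- (2 / C) * t) * (E 0 - 1)"
  proof (rule gronwall_decay[OF t])
    show "continuous_on {0..} (\<lambda>s. E s - 1)"
      using diff unfolding differentiable_under_integral_def E_def by (intro continuous_intros) simp
    show "((\<lambda>s. E s - 1) has_real_derivative - 2 * D s) (at s)" if "0 < s" for s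
      using key[OF that] by (auto intro!: derivative_eq_intros)
    show "- 2 * D s \<le> - (2 / C) * (E s - 1)" if "0 < s" for s
      using key[OF that] C by (simp add: field_simps)
  qed
  then show ?thesis by (simp add: E_def)
qed

theorem theorem1:
  fixes V \<phi> :: "real^'d \<Rightarrow> real"
    and M :: "'w measure" and F :: "real \<Rightarrow> 'w measure"
    and B X Y :: "real \<Rightarrow> 'w \<Rightarrow> real^'d"
    and C\<^sub>M\<^sub>P t :: real
  assumes "twice_continuously_differentiable V"
    and "prob_space (target V)"
    and "mirror_map \<phi>"
    and "\<forall>x. invertible (hess \<phi> x)"
    and "mirror_langevin_diffusion M F B \<phi> V X Y"
    and "regular_law \<phi> V (law M X)"
    and "C\<^sub>M\<^sub>P > 0"
    and "mirror_poincare \<phi> V C\<^sub>M\<^sub>P"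
    and "t \<ge> 0"
  shows "ereal (2 * (TV_dist (law M X t) (target V))\<^sup>2)
           \<le> ereal (exp (- 2 * t / C\<^sub>M\<^sub>P)) * chi_square (law M X 0) (target V) \<and>
         hellinger_sq (law M X t) (target V)
           \<le> ereal (exp (- 2 * t / C\<^sub>M\<^sub>P)) * chi_square (law M X 0) (target V) \<and>
         KL_div (law M X t) (target V)
           \<le> ereal (exp (- 2 * t / C\<^sub>M\<^sub>P)) * chi_square (law M X 0) (target V) \<and>
         chi_square (law M X t) (target V)
           \<le> ereal (exp (- 2 * t / C\<^sub>M\<^sub>P)) * chi_square (law M X 0) (target V)"
proof (cases "chi_square (law M X 0) (target V) < \<infinity>")
  \<comment> \<open>The initial divergence is \<infinity>, and so is its product with the positive
    exponential.\<close>
  case False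
  then show ?thesis by simp
next
  case True
  \<comment> \<open>Finiteness makes \<open>m 0\<close> a density of the initial law, so positive
    times and time 0 can be treated together.\<close>
  then obtain m where dens: "\<And>s. 0 \<le> s \<Longrightarrow> lebesgue_density (law M X s) (m s)"
    and fp: "fokker_planck_solution \<phi> V (law M X 0) m"
    and diff: "differentiable_under_integral V m" and nb: "no_boundary_terms \<phi> V m"
    using assms(6) unfolding regular_law_def by (metis less_eq_real_def)
  note prob = prob_space_law[OF assms(5)]
  have V: "\<And>x. V differentiable at x"
    using assms(1) by (simp add: twice_continuously_differentiable_def)
  then have [measurable]: "V \<in> borel_measurable borel"
    by (intro borel_measurable_continuous_onI)
      (simp add: differentiable_imp_continuous_on differentiable_at_imp_differentiable_on)
  have tgt: "lebesgue_density (target V) (\<lambda>x. exp (- V x))"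
    by (auto simp: lebesgue_density_def target_def)
  have sq: "integrable lborel (\<lambda>x. (m s x)\<^sup>2 / exp (- V x))" if "0 \<le> s" for s
    using diff that unfolding differentiable_under_integral_def by simp
  note h = lebesgue_density_ratio[OF dens tgt exp_gt_zero prob assms(2) sq]
  have [measurable]: "m t \<in> borel_measurable borel" and unn: "\<And>x. 0 \<le> m t x / exp (- V x)"
    using dens[OF assms(9)] by (simp_all add: lebesgue_density_def)
  have um: "(\<lambda>x. m t x / exp (- V x)) \<in> borel_measurable (target V)"
    by (simp add: target_def)
  \<comment> \<open>The premise 0 \<le> t is discharged three times: for the density, for the
    probability law and for integrability of the square.\<close>
  note r = assms(2) um unn h(3)[OF assms(9,9,9)] prob[OF assms(9)] h(4)[OF assms(9,9,9)]
  have "chi_square (law M X t) (target V)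
      \<le> ereal (exp (- 2 * t / C\<^sub>M\<^sub>P)) * chi_square (law M X 0) (target V)"
    using chi_square_decay[OF V assms(2,3) _ dens prob fp diff nb assms(7-9)] assms(4,9)
    by (simp add: h(2))
  \<comment> \<open>At time \<open>t\<close> the other three quantities lie below the chi-square
    divergence, whose decay they inherit.\<close>
  then show ?thesis
    using TV_dist_le_chi_square[OF r] KL_div_le_chi_square[OF r] h(1)[OF assms(9,9,9)]
    by (blast intro: order_trans)
qed

end
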